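(* For all $\Delta\cup\{\phi\}\subseteq\mathrm{Fm}_{\mathrm{PT}^+}$: $$\Delta\vDash_{\mathrm{PT}^+}\phi\quad\text{iff}\quad\mathrm{PVA}\cup\Delta\vDash\phi,$$ where $\mathrm{PVA}=\{\Box(P_i\mathbin{\dot\vee}\mathord{\sim}P_i)\mid i\in\mathbb{N}\}$ and $\vDash$ is entailment in LTP.
   Context: **LTP.** Boolean algebras $B$ are written with operations $0,1,-,+,\cdot$ (bottom, top, complement, join, meet); the one-element Boolean algebra is allowed. The powerset $\mathcal{P}(B)$ carries external operations $\bot=\emptyset$, $\neg X=B\setminus X$, $X\vee Y=X\cup Y$, $X\wedge Y=X\cap Y$, and internal operations $\dot\bot=\{0\}$, $\dot\neg X=\{-a\mid a\in X\}$, $X\mathbin{\dot\vee}Y=\{a+b\mid a\in X,b\in Y\}$, $X\mathbin{\dot\wedge}Y=\{a\cdot b\mid a\in X,b\in Y\}$. The formulas of LTP form the absolutely free algebra $\mathrm{Fm}$ generated by propositional variables $P_0,P_1,\dots$ using constants $\bot,\dot\bot$, unary $\neg,\dot\neg$, and binary $\vee,\wedge,\dot\vee,\dot\wedge$. Homomorphisms $H:\mathrm{Fm}\to\mathcal{P}(B)$ preserve all eight operations. $\Delta\vDash\psi$ iff for all Boolean algebras $B$ and all homomorphisms $H:\mathrm{Fm}\to\mathcal{P}(B)$, $\bigcap_{\delta\in\Delta}H(\delta)\subseteq H(\psi)$ (the empty intersection being $B$). Abbreviations in $\mathrm{Fm}$: $\top:=\neg\bot$, $\mathrm{NB}:=\neg\dot\bot$,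 $\mathord{\downarrow}\phi:=\phi\mathbin{\dot\wedge}\top$, $\mathord{\uparrow}\phi:=\phi\mathbin{\dot\vee}\top$, $\Box\phi:=\neg\mathord{\uparrow}\mathord{\downarrow}\neg\phi$, and strict negation $\mathord{\sim}\phi:=\neg\mathord{\uparrow}(\mathord{\downarrow}\phi\wedge\mathrm{NB})$. **Strong propositional team logic $\mathrm{PT}^+$.** The set $\mathrm{Fm}_{\mathrm{PT}^+}$ is given by the grammar $$\phi::=P_i\mid\mathord{\sim}P_i\mid\dot\bot\mid\mathrm{NB}\mid\phi\mathbin{\dot\vee}\phi\mid\phi\wedge\phi\mid\phi\vee\phi,$$ and via the abbreviations above it is regarded as a subset of $\mathrm{Fm}$. Its valuational team semantics assigns to each formula a set $[\![\phi]\!]\subseteq\mathcal{P}(2^{\mathbb{N}})$ of teams (sets of valuations $s:\mathbb{N}\to\{0,1\}$): $[\![P_i]\!]=\{X\mid s(i)=1\text{ for all }s\in X\}$; $[\![\mathord{\sim}P_i]\!]=\{X\mid s(i)=0\text{ for all }s\in X\}$; $[\![\dot\bot]\!]=\{\emptyset\}$; $[\![\mathrm{NB}]\!]=\{X\mid X\neq\emptyset\}$; $[\![\phi\mathbin{\dot\vee}\psi]\!]=\{X\cup Y\mid X\in[\![\phi]\!],Y\in[\![\psi]\!]\}$; $[\![\phi\wedge\psi]\!]=[\![\phi]\!]\cap[\![\psi]\!]$; $[\![\phi\vee\psi]\!]=[\![\phi]\!]\cup[\![\psi]\!]$. Entailment: $\Delta\vDash_{\mathrm{PT}^+}\phi$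 iff $\bigcap_{\delta\in\Delta}[\![\delta]\!]\subseteq[\![\phi]\!]$ (the empty intersection being $\mathcal{P}(2^{\mathbb{N}})$). *)

theory Defs
  imports Main "HOL-Library.Countable_Set"
begin

section \<open>Boolean algebras with explicit carrier\<close>

text \<open>
  Carriers are needed because LTP entailment quantifies over Boolean algebras of every
  cardinality, including the one-element one, inside a single formula. The axioms are those of
  the library locale \<^locale>\<open>abstract_boolean_algebra\<close>, relativised to the carrier.
\<close>

record 'b balg =
  carrier :: "'b set"
  zero :: 'b
  one :: 'b
  compl :: "'b \<Rightarrow> 'b"
  join :: "'b \<Rightarrow> 'b \<Rightarrow> 'b"
  meet :: "'b \<Rightarrow> 'b \<Rightarrow> 'b"

locale boolean_alg =
  fixes A :: "'b balg"
  assumes zero_closed: "zero A \<in> carrier A"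
    and one_closed: "one A \<in> carrier A"
    and compl_closed: "x \<in> carrier A \<Longrightarrow> compl A x \<in> carrier A"
    and join_closed: "x \<in> carrier A \<Longrightarrow> y \<in> carrier A \<Longrightarrow> join A x y \<in> carrier A"
    and meet_closed: "x \<in> carrier A \<Longrightarrow> y \<in> carrier A \<Longrightarrow> meet A x y \<in> carrier A"
    and join_assoc: "x \<in> carrier A \<Longrightarrow> y \<in> carrier A \<Longrightarrow> z \<in> carrier A \<Longrightarrow>
      join A (join A x y) z = join A x (join A y z)"
    and meet_assoc: "x \<in> carrier A \<Longrightarrow> y \<in> carrier A \<Longrightarrow> z \<in> carrier A \<Longrightarrow>
      meet A (meet A x y) z = meet A x (meet A y z)"
    and join_comm: "x \<in> carrier A \<Longrightarrow> y \<in> carrier A \<Longrightarrow> join A x y = join A y x"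
    and meet_comm: "x \<in> carrier A \<Longrightarrow> y \<in> carrier A \<Longrightarrow> meet A x y = meet A y x"
    and meet_join_distrib: "x \<in> carrier A \<Longrightarrow> y \<in> carrier A \<Longrightarrow> z \<in> carrier A \<Longrightarrow>
      meet A x (join A y z) = join A (meet A x y) (meet A x z)"
    and join_meet_distrib: "x \<in> carrier A \<Longrightarrow> y \<in> carrier A \<Longrightarrow> z \<in> carrier A \<Longrightarrow>
      join A x (meet A y z) = meet A (join A x y) (join A x z)"
    and join_zero: "x \<in> carrier A \<Longrightarrow> join A x (zero A) = x"
    and meet_one: "x \<in> carrier A \<Longrightarrow> meet A x (one A) = x"
    and join_compl: "x \<in> carrier A \<Longrightarrow> join A x (compl A x) = one A"
    and meet_compl: "x \<in> carrier A \<Longrightarrow> meet A x (compl A x) = zero A"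


section \<open>The logic LTP\<close>

text \<open>The prefix \<open>I\<close> marks the internal (dotted) connectives.\<close>

datatype fm =
    Var nat
  | Bot | IBot
  | Neg fm | INeg fm
  | Or fm fm | And fm fm
  | IOr fm fm | IAnd fm fm

instance fm :: countable
  by countable_datatype

definition ltp_hom :: "'b balg \<Rightarrow> (fm \<Rightarrow> 'b set) \<Rightarrow> bool" where
  "ltp_hom A H \<longleftrightarrow>
     (\<forall>\<phi>. H \<phi> \<subseteq> carrier A) \<and>
     H Bot = {} \<and>
     (\<forall>\<phi>. H (Neg \<phi>) = carrier A - H \<phi>) \<and>
     (\<forall>\<phi> \<psi>. H (Or \<phi> \<psi>) = H \<phi> \<union> H \<psi>) \<and>
     (\<forall>\<phi> \<psi>. H (And \<phi> \<psi>) = H \<phi> \<inter> H \<psi>) \<and>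
     H IBot = {zero A} \<and>
     (\<forall>\<phi>. H (INeg \<phi>) = {compl A a |a. a \<in> H \<phi>}) \<and>
     (\<forall>\<phi> \<psi>. H (IOr \<phi> \<psi>) = {join A a b |a b. a \<in> H \<phi> \<and> b \<in> H \<psi>}) \<and>
     (\<forall>\<phi> \<psi>. H (IAnd \<phi> \<psi>) = {meet A a b |a b. a \<in> H \<phi> \<and> b \<in> H \<psi>})"

text \<open>
  HOL cannot quantify over all types inside a formula, so entailment carries the type \<open>'u\<close> in
  which the carriers of the Boolean algebras live. Lemma \<open>ltp_entails_universe\<close> below shows that
  every infinite \<open>'u\<close> gives the same relation, namely entailment over the Boolean algebras of all
  types.
\<close>

definition ltp_entails :: "'u itself \<Rightarrow> fm set \<Rightarrow> fm \<Rightarrow> bool" where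
  "ltp_entails (_ :: 'u itself) \<Delta> \<psi> \<longleftrightarrow>
     (\<forall>(A :: 'u balg) H. boolean_alg A \<longrightarrow> ltp_hom A H \<longrightarrow>
        carrier A \<inter> (\<Inter>\<delta>\<in>\<Delta>. H \<delta>) \<subseteq> H \<psi>)"

definition Top :: fm where "Top = Neg Bot"
definition NB :: fm where "NB = Neg IBot"
definition Down :: "fm \<Rightarrow> fm" where "Down \<phi> = IAnd \<phi> Top"
definition Up :: "fm \<Rightarrow> fm" where "Up \<phi> = IOr \<phi> Top"
definition Box :: "fm \<Rightarrow> fm" where "Box \<phi> = Neg (Up (Down (Neg \<phi>)))"
definition SNeg :: "fm \<Rightarrow> fm" where "SNeg \<phi> = Neg (Up (And (Down \<phi>) NB))"

definition PVA :: "fm set" where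
  "PVA = {Box (IOr (Var i) (SNeg (Var i))) |i. True}"


section \<open>Strong propositional team logic\<close>

datatype pt_fm =
    PVar nat | PNegVar nat
  | PIBot | PNB
  | PIOr pt_fm pt_fm | PAnd pt_fm pt_fm | POr pt_fm pt_fm

primrec fm_of :: "pt_fm \<Rightarrow> fm" where
  "fm_of (PVar i) = Var i"
| "fm_of (PNegVar i) = SNeg (Var i)"
| "fm_of PIBot = IBot"
| "fm_of PNB = NB"
| "fm_of (PIOr \<phi> \<psi>) = IOr (fm_of \<phi>) (fm_of \<psi>)"
| "fm_of (PAnd \<phi> \<psi>) = And (fm_of \<phi>) (fm_of \<psi>)"
| "fm_of (POr \<phi> \<psi>) = Or (fm_of \<phi>) (fm_of \<psi>)"

text \<open>Hence team logic formulas may be identified with their images in \<^typ>\<open>fm\<close>.\<close>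

lemma inj_fm_of: "inj fm_of"
proof (rule injI)
  fix \<phi> \<psi>
  show "fm_of \<phi> = fm_of \<psi> \<Longrightarrow> \<phi> = \<psi>"
  proof (induction \<phi> arbitrary: \<psi>)
  qed (case_tac \<psi>; auto simp: SNeg_def NB_def Up_def Down_def)+
qed

type_synonym team = "(nat \<Rightarrow> bool) set"

primrec pt_sem :: "pt_fm \<Rightarrow> team set" where
  "pt_sem (PVar i) = {X. \<forall>s\<in>X. s i}"
| "pt_sem (PNegVar i) = {X. \<forall>s\<in>X. \<not> s i}"
| "pt_sem PIBot = {{}}"
| "pt_sem PNB = {X. X \<noteq> {}}"
| "pt_sem (PIOr \<phi> \<psi>) = {X \<union> Y |X Y. X \<in> pt_sem \<phi> \<and> Y \<in> pt_sem \<psi>}"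
| "pt_sem (PAnd \<phi> \<psi>) = pt_sem \<phi> \<inter> pt_sem \<psi>"
| "pt_sem (POr \<phi> \<psi>) = pt_sem \<phi> \<union> pt_sem \<psi>"

definition pt_entails :: "pt_fm set \<Rightarrow> pt_fm \<Rightarrow> bool" where
  "pt_entails \<Delta> \<phi> \<longleftrightarrow> (\<Inter>\<delta>\<in>\<Delta>. pt_sem \<delta>) \<subseteq> pt_sem \<phi>"


section \<open>Independence of LTP entailment from the universe\<close>

text \<open>
  A downward Loewenheim-Skolem argument: a countermodel restricts to a countable subalgebra that
  is closed under witnesses for the internal connectives.
\<close>

lemma countable_closure:
  fixes F :: "'a \<Rightarrow> 'a \<Rightarrow> 'a set"
  assumes "countable X" and "X \<subseteq> U"
    and F: "\<And>x y. x \<in> U \<Longrightarrow> y \<in> U \<Longrightarrow> countable (F x y) \<and> F x y \<subseteq> U"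
  obtains C where "countable C" "X \<subseteq> C" "C \<subseteq> U" "\<And>x y. x \<in> C \<Longrightarrow> y \<in> C \<Longrightarrow> F x y \<subseteq> C"
proof -
  define S where "S Y = Y \<union> (\<Union>x\<in>Y. \<Union>y\<in>Y. F x y)" for Y
  define D where "D n = (S ^^ n) X" for n
  have D0: "D 0 = X" and DS: "D (Suc n) = S (D n)" for n
    by (simp_all add: D_def)
  have sub: "D n \<subseteq> U" for n
  proof (induction n)
    case 0
    then show ?case using assms by (simp add: D0)
  next
    case (Suc n)
    then show ?case using F unfolding DS S_def by blast
  qed
  have cnt: "countable (D n)" for n
  proof (induction n)
    case 0
    then show ?case using assms by (simp add: D0)
  next
    case (Suc n)
    have "countable (F x y)" if "x \<in> D n" "y \<in> D n" for x y
      using F sub that by blast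
    with Suc show ?case unfolding DS S_def by (intro countable_Un countable_UN) auto
  qed
  have mono: "D m \<subseteq> D n" if "m \<le> n" for m n
    using that by (rule lift_Suc_mono_le[rotated]) (auto simp: DS S_def)
  show ?thesis
  proof (rule that[of "\<Union>n. D n"])
    show "X \<subseteq> (\<Union>n. D n)" using D0 by blast
    fix x y assume "x \<in> (\<Union>n. D n)" "y \<in> (\<Union>n. D n)"
    then obtain m n where "x \<in> D m" "y \<in> D n" by blast
    then have "x \<in> D (max m n)" "y \<in> D (max m n)"
      using mono[of m "max m n"] mono[of n "max m n"] by auto
    then have "F x y \<subseteq> D (Suc (max m n))" unfolding DS S_def by blast
    then show "F x y \<subseteq> (\<Union>n. D n)" by blast
  qed (use sub cnt in auto)
qed

lemma ltp_entails_universe: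
  assumes inf: "infinite (UNIV :: 'u set)"
    and ent: "ltp_entails TYPE('u) \<Delta> \<psi>"
  shows "ltp_entails TYPE('v) \<Delta> \<psi>"
  unfolding ltp_entails_def
proof (intro allI impI subsetI)
  fix A :: "'v balg" and H a
  assume BA: "boolean_alg A" and hom: "ltp_hom A H" and a: "a \<in> carrier A \<inter> (\<Inter>\<delta>\<in>\<Delta>. H \<delta>)"
  interpret boolean_alg A by (rule BA)
  have sub: "H \<chi> \<subseteq> carrier A" for \<chi> using hom by (simp add: ltp_hom_def)
  have ext: "H Bot = {}" "\<And>\<chi>. H (Neg \<chi>) = carrier A - H \<chi>" "H IBot = {zero A}"
      "\<And>\<chi> \<xi>. H (Or \<chi> \<xi>) = H \<chi> \<union> H \<xi>" "\<And>\<chi> \<xi>. H (And \<chi> \<xi>) = H \<chi> \<inter> H \<xi>"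
    using hom by (simp_all add: ltp_hom_def)
  have int: "\<And>\<chi>. H (INeg \<chi>) = {compl A b |b. b \<in> H \<chi>}"
      "\<And>\<chi> \<xi>. H (IOr \<chi> \<xi>) = {join A b c |b c. b \<in> H \<chi> \<and> c \<in> H \<xi>}"
      "\<And>\<chi> \<xi>. H (IAnd \<chi> \<xi>) = {meet A b c |b c. b \<in> H \<chi> \<and> c \<in> H \<xi>}"
    using hom by (simp_all add: ltp_hom_def)
  have "\<exists>y. x \<in> H (INeg \<chi>) \<longrightarrow> y \<in> H \<chi> \<and> x = compl A y" for x \<chi>
    unfolding int by blast
  then obtain n where n: "\<And>x \<chi>. x \<in> H (INeg \<chi>) \<Longrightarrow> n x \<chi> \<in> H \<chi> \<and> x = compl A (n x \<chi>)"
    by metis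
  have "\<exists>y z. x \<in> H (IOr \<chi> \<xi>) \<longrightarrow> y \<in> H \<chi> \<and> z \<in> H \<xi> \<and> x = join A y z" for x \<chi> \<xi>
    unfolding int by blast
  then obtain j1 j2 where j: "\<And>x \<chi> \<xi>. x \<in> H (IOr \<chi> \<xi>) \<Longrightarrow>
      j1 x \<chi> \<xi> \<in> H \<chi> \<and> j2 x \<chi> \<xi> \<in> H \<xi> \<and> x = join A (j1 x \<chi> \<xi>) (j2 x \<chi> \<xi>)"
    by metis
  have "\<exists>y z. x \<in> H (IAnd \<chi> \<xi>) \<longrightarrow> y \<in> H \<chi> \<and> z \<in> H \<xi> \<and> x = meet A y z" for x \<chi> \<xi>
    unfolding int by blast
  then obtain m1 m2 where m: "\<And>x \<chi> \<xi>. x \<in> H (IAnd \<chi> \<xi>) \<Longrightarrow>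
      m1 x \<chi> \<xi> \<in> H \<chi> \<and> m2 x \<chi> \<xi> \<in> H \<xi> \<and> x = meet A (m1 x \<chi> \<xi>) (m2 x \<chi> \<xi>)"
    by metis
  define F where "F x y = {compl A x, join A x y, meet A x y} \<union>
    (carrier A \<inter> (\<Union>\<chi> \<xi>. {n x \<chi>, j1 x \<chi> \<xi>, j2 x \<chi> \<xi>, m1 x \<chi> \<xi>, m2 x \<chi> \<xi>}))" for x y
  have F: "countable (F x y) \<and> F x y \<subseteq> carrier A" if "x \<in> carrier A" "y \<in> carrier A" for x y
  proof
    show "countable (F x y)"
      unfolding F_def by (intro countable_Un countable_Int2 countable_UN) simp_all
    show "F x y \<subseteq> carrier A"
      using that compl_closed join_closed meet_closed unfolding F_def by blast
  qed
  have "countable {a, zero A, one A}" "{a, zero A, one A} \<subseteq> carrier A"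
    using a zero_closed one_closed by auto
  from countable_closure[where F = F, OF this F]
  obtain C where C: "countable C" "{a, zero A, one A} \<subseteq> C" "C \<subseteq> carrier A"
      and cl: "\<And>x y. x \<in> C \<Longrightarrow> y \<in> C \<Longrightarrow> F x y \<subseteq> C"
    by blast
  have ops: "compl A x \<in> C" "join A x y \<in> C" "meet A x y \<in> C" if "x \<in> C" "y \<in> C" for x y
    using cl[OF that] by (auto simp: F_def)
  have wn: "n x \<chi> \<in> C" if "x \<in> C" "x \<in> H (INeg \<chi>)" for x \<chi>
    using cl[OF that(1) that(1)] n[OF that(2)] sub unfolding F_def by blast
  have wj: "j1 x \<chi> \<xi> \<in> C" "j2 x \<chi> \<xi> \<in> C" if "x \<in> C" "x \<in> H (IOr \<chi> \<xi>)" for x \<chi> \<xi>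
    using cl[OF that(1) that(1)] j[OF that(2)] sub unfolding F_def by blast+
  have wm: "m1 x \<chi> \<xi> \<in> C" "m2 x \<chi> \<xi> \<in> C" if "x \<in> C" "x \<in> H (IAnd \<chi> \<xi>)" for x \<chi> \<xi>
    using cl[OF that(1) that(1)] m[OF that(2)] sub unfolding F_def by blast+
  obtain e :: "nat \<Rightarrow> 'u" where "inj e"
    using infinite_countable_subset[OF inf] by blast
  define g where "g = e \<circ> to_nat_on C"
  have g: "inj_on g C"
    unfolding g_def using \<open>inj e\<close> C(1)
    by (intro comp_inj_on inj_on_to_nat_on) (auto intro: inj_on_subset)
  define h where "h = inv_into C g"
  have hg: "h (g x) = x" if "x \<in> C" for x
    using g that by (simp add: h_def)
  define A' :: "'u balg" where "A' = \<lparr> carrier = g ` C, zero = g (zero A), one = g (one A),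
    compl = (\<lambda>x. g (compl A (h x))), join = (\<lambda>x y. g (join A (h x) (h y))),
    meet = (\<lambda>x y. g (meet A (h x) (h y))) \<rparr>"
  define H' where "H' \<chi> = g ` (C \<inter> H \<chi>)" for \<chi>
  have CA: "x \<in> carrier A" if "x \<in> C" for x using C(3) that by blast
  have c01: "zero A \<in> C" "one A \<in> C" "a \<in> C" using C(2) by auto
  have BA': "boolean_alg A'"
  proof
    fix x y z
    assume "x \<in> carrier A'" "y \<in> carrier A'"
    then obtain x0 y0 where xy: "x0 \<in> C" "y0 \<in> C" "x = g x0" "y = g y0"
      by (auto simp: A'_def)
    then show "join A' x y = join A' y x" "meet A' x y = meet A' y x"
      using join_comm[of x0 y0] meet_comm[of x0 y0] CA by (simp_all add: A'_def hg)
    assume "z \<in> carrier A'"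
    then obtain z0 where "z0 \<in> C" "z = g z0" by (auto simp: A'_def)
    with xy show "join A' (join A' x y) z = join A' x (join A' y z)"
        "meet A' (meet A' x y) z = meet A' x (meet A' y z)"
        "meet A' x (join A' y z) = join A' (meet A' x y) (meet A' x z)"
        "join A' x (meet A' y z) = meet A' (join A' x y) (join A' x z)"
      using join_assoc[of x0 y0 z0] meet_assoc[of x0 y0 z0]
        meet_join_distrib[of x0 y0 z0] join_meet_distrib[of x0 y0 z0] CA
      by (simp_all add: A'_def hg ops)
  qed (auto simp: A'_def hg ops c01 CA join_zero meet_one join_compl meet_compl)
  have hI: "H' (INeg \<chi>) = {compl A' b |b. b \<in> H' \<chi>}" for \<chi>
  proof (intro set_eqI iffI)
    fix x assume "x \<in> H' (INeg \<chi>)"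
    then obtain y where y: "y \<in> C" "y \<in> H (INeg \<chi>)" "x = g y" by (auto simp: H'_def)
    then have "x = compl A' (g (n y \<chi>))" "g (n y \<chi>) \<in> H' \<chi>"
      using n[OF y(2)] wn[OF y(1,2)] by (auto simp: A'_def H'_def hg)
    then show "x \<in> {compl A' b |b. b \<in> H' \<chi>}" by blast
  next
    fix x assume "x \<in> {compl A' b |b. b \<in> H' \<chi>}"
    then obtain b where "b \<in> C" "b \<in> H \<chi>" "x = g (compl A b)" by (auto simp: A'_def H'_def hg)
    moreover from this have "compl A b \<in> H (INeg \<chi>)" unfolding int by blast
    ultimately show "x \<in> H' (INeg \<chi>)" using ops by (auto simp: H'_def)
  qed
  have hJ: "H' (IOr \<chi> \<xi>) = {join A' b c |b c. b \<in> H' \<chi> \<and> c \<in> H' \<xi>}" for \<chi> \<xi>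
  proof (intro set_eqI iffI)
    fix x assume "x \<in> H' (IOr \<chi> \<xi>)"
    then obtain y where y: "y \<in> C" "y \<in> H (IOr \<chi> \<xi>)" "x = g y" by (auto simp: H'_def)
    then have "x = join A' (g (j1 y \<chi> \<xi>)) (g (j2 y \<chi> \<xi>))"
        "g (j1 y \<chi> \<xi>) \<in> H' \<chi>" "g (j2 y \<chi> \<xi>) \<in> H' \<xi>"
      using j[OF y(2)] wj[OF y(1,2)] by (auto simp: A'_def H'_def hg)
    then show "x \<in> {join A' b c |b c. b \<in> H' \<chi> \<and> c \<in> H' \<xi>}" by blast
  next
    fix x assume "x \<in> {join A' b c |b c. b \<in> H' \<chi> \<and> c \<in> H' \<xi>}"
    then obtain b c where "b \<in> C" "b \<in> H \<chi>" "c \<in> C" "c \<in> H \<xi>" "x = g (join A b c)"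
      by (auto simp: A'_def H'_def hg)
    moreover from this have "join A b c \<in> H (IOr \<chi> \<xi>)" unfolding int by blast
    ultimately show "x \<in> H' (IOr \<chi> \<xi>)" using ops by (auto simp: H'_def)
  qed
  have hM: "H' (IAnd \<chi> \<xi>) = {meet A' b c |b c. b \<in> H' \<chi> \<and> c \<in> H' \<xi>}" for \<chi> \<xi>
  proof (intro set_eqI iffI)
    fix x assume "x \<in> H' (IAnd \<chi> \<xi>)"
    then obtain y where y: "y \<in> C" "y \<in> H (IAnd \<chi> \<xi>)" "x = g y" by (auto simp: H'_def)
    then have "x = meet A' (g (m1 y \<chi> \<xi>)) (g (m2 y \<chi> \<xi>))"
        "g (m1 y \<chi> \<xi>) \<in> H' \<chi>" "g (m2 y \<chi> \<xi>) \<in> H' \<xi>"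
      using m[OF y(2)] wm[OF y(1,2)] by (auto simp: A'_def H'_def hg)
    then show "x \<in> {meet A' b c |b c. b \<in> H' \<chi> \<and> c \<in> H' \<xi>}" by blast
  next
    fix x assume "x \<in> {meet A' b c |b c. b \<in> H' \<chi> \<and> c \<in> H' \<xi>}"
    then obtain b c where "b \<in> C" "b \<in> H \<chi>" "c \<in> C" "c \<in> H \<xi>" "x = g (meet A b c)"
      by (auto simp: A'_def H'_def hg)
    moreover from this have "meet A b c \<in> H (IAnd \<chi> \<xi>)" unfolding int by blast
    ultimately show "x \<in> H' (IAnd \<chi> \<xi>)" using ops by (auto simp: H'_def)
  qed
  have cA': "carrier A' = g ` C" and zA': "zero A' = g (zero A)" by (simp_all add: A'_def)
  have "H' (Neg \<chi>) = carrier A' - H' \<chi>" for \<chi>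
    using inj_onD[OF g] CA unfolding H'_def cA' ext by blast
  moreover have "H' (And \<chi> \<xi>) = H' \<chi> \<inter> H' \<xi>" for \<chi> \<xi>
    using inj_onD[OF g] unfolding H'_def ext by blast
  moreover have "H' (Or \<chi> \<xi>) = H' \<chi> \<union> H' \<xi>" for \<chi> \<xi>
    unfolding H'_def ext by blast
  moreover have "H' Bot = {}" "H' IBot = {zero A'}" "\<And>\<chi>. H' \<chi> \<subseteq> carrier A'"
    unfolding H'_def cA' zA' ext using c01 by auto
  ultimately have hom': "ltp_hom A' H'"
    unfolding ltp_hom_def using hI hJ hM by (intro conjI allI) assumption+
  have "g a \<in> carrier A' \<inter> (\<Inter>\<delta>\<in>\<Delta>. H' \<delta>)"
    using a c01 by (auto simp: H'_def cA')
  then have "g a \<in> H' \<psi>"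
    using ent BA' hom' unfolding ltp_entails_def by blast
  then show "a \<in> H \<psi>"
    using inj_onD[OF g] c01 by (auto simp: H'_def)
qed

end

theory Submission
  imports Defs
begin

text \<open>
  In a Boolean algebra \<open>B\<close> satisfying PVA, the value of each \<open>P\<^sub>i\<close> is a principal ideal, generated
  by \<open>p\<^sub>i\<close> say. Send \<open>a \<in> B\<close> to the team of all valuations \<open>s\<close> such that \<open>a\<close> meets every finite
  conjunction of the literals \<open>\<plusminus>p\<^sub>i\<close> prescribed by \<open>s\<close>; this is the image of the clopen set \<open>a\<close>
  under the map from the Stone space of \<open>B\<close> to the Cantor space induced by \<open>p\<close>, described without
  ultrafilters. An element then satisfies a formula iff its team does. The only
  non-trivial case is the internal disjunction: a split of the team need not come from a split of \<open>a\<close>,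
  but formulas see only finitely many variables, so the two halves may be replaced by finite unions
  of cylinders, and these are represented by elements of \<open>B\<close>. Conversely, team semantics is the
  interpretation in the powerset algebra of all valuations, which satisfies PVA.
\<close>

section \<open>Boolean arithmetic relative to a carrier\<close>

context boolean_alg
begin

abbreviation meet_A (infixl "\<sqinter>" 70) where "x \<sqinter> y \<equiv> meet A x y"
abbreviation join_A (infixl "\<squnion>" 65) where "x \<squnion> y \<equiv> join A x y"
abbreviation "\<zz> \<equiv> zero A"
abbreviation "\<uu> \<equiv> one A"

lemmas closed [simp] = zero_closed one_closed compl_closed join_closed meet_closed

lemmas units [simp] = join_zero meet_one join_compl meet_compl

lemma meet_left_comm:
  assumes "x \<in> carrier A" "y \<in> carrier A" "z \<in> carrier A"
  shows "x \<sqinter> (y \<sqinter> z) = y \<sqinter> (x \<sqinter> z)"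
  using assms by (metis meet_assoc meet_comm)

lemmas meet_ac = meet_assoc meet_comm meet_left_comm

lemma join_meet_distrib_right:
  assumes "x \<in> carrier A" "y \<in> carrier A" "z \<in> carrier A"
  shows "(x \<squnion> y) \<sqinter> z = x \<sqinter> z \<squnion> y \<sqinter> z"
  using assms by (metis meet_join_distrib meet_comm join_closed)

lemma zero_join [simp]: "x \<in> carrier A \<Longrightarrow> \<zz> \<squnion> x = x"
  using join_comm[of \<zz> x] by simp

lemma one_meet [simp]: "x \<in> carrier A \<Longrightarrow> \<uu> \<sqinter> x = x"
  using meet_comm[of \<uu> x] by simp

lemma meet_zero [simp]:
  assumes x: "x \<in> carrier A"
  shows "x \<sqinter> \<zz> = \<zz>"
proof -
  have "x \<sqinter> \<zz> = x \<sqinter> \<zz> \<squnion> x \<sqinter> compl A x" using x by simp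
  also have "\<dots> = x \<sqinter> (\<zz> \<squnion> compl A x)" using x by (subst meet_join_distrib) simp_all
  finally show ?thesis using x by simp
qed

lemma zero_meet [simp]: "x \<in> carrier A \<Longrightarrow> \<zz> \<sqinter> x = \<zz>"
  using meet_comm[of \<zz> x] by simp

lemma join_one [simp]:
  assumes x: "x \<in> carrier A"
  shows "x \<squnion> \<uu> = \<uu>"
proof -
  have "x \<squnion> \<uu> = (x \<squnion> \<uu>) \<sqinter> (x \<squnion> compl A x)" using x by simp
  also have "\<dots> = x \<squnion> \<uu> \<sqinter> compl A x" using x by (subst join_meet_distrib) simp_all
  finally show ?thesis using x by simp
qed

lemma meet_idem [simp]:
  assumes x: "x \<in> carrier A"
  shows "x \<sqinter> x = x"
proof -
  have "x \<sqinter> x = x \<sqinter> x \<squnion> x \<sqinter> compl A x" using x by simp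
  also have "\<dots> = x \<sqinter> (x \<squnion> compl A x)" using x by (subst meet_join_distrib) simp_all
  finally show ?thesis using x by simp
qed

lemma join_absorb:
  assumes "x \<in> carrier A" "y \<in> carrier A"
  shows "x \<squnion> x \<sqinter> y = x"
proof -
  have "x \<squnion> x \<sqinter> y = x \<sqinter> (\<uu> \<squnion> y)"
    using assms by (simp add: meet_join_distrib)
  also have "\<uu> \<squnion> y = \<uu>"
    using assms join_comm[of \<uu> y] by simp
  finally show ?thesis using assms by simp
qed

lemma meet_absorb:
  assumes "x \<in> carrier A" "y \<in> carrier A"
  shows "x \<sqinter> (x \<squnion> y) = x"
  using assms by (simp add: meet_join_distrib join_absorb)

lemma join_eq_zero_iff:
  assumes "x \<in> carrier A" "y \<in> carrier A"
  shows "x \<squnion> y = \<zz> \<longleftrightarrow> x = \<zz> \<and> y = \<zz>"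
  using assms by (metis meet_absorb meet_zero join_comm join_zero zero_closed)

lemma meet_split:
  assumes "x \<in> carrier A" "y \<in> carrier A"
  shows "x \<sqinter> y \<squnion> x \<sqinter> compl A y = x"
  using assms by (simp flip: meet_join_distrib)

lemma le_if_meet_compl:
  assumes "x \<in> carrier A" "y \<in> carrier A" "x \<sqinter> compl A y = \<zz>"
  shows "x \<sqinter> y = x"
  using meet_split[OF assms(1,2)] assms by simp

end

section \<open>Cylinders, cells and the team of an element\<close>

definition cylinder :: "nat \<Rightarrow> team \<Rightarrow> team" where
  "cylinder n Y = {s. \<exists>t\<in>Y. \<forall>i<n. s i = t i}"

lemma cylinder_Suc:
  "cylinder (Suc n) Y = (\<Union>v. cylinder n {t\<in>Y. t n = v} \<inter> {s. s n = v})"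
  by (auto simp: cylinder_def less_Suc_eq)

locale valued_boolean_alg = boolean_alg A for A :: "'b balg" +
  fixes p :: "nat \<Rightarrow> 'b"
  assumes p_closed [simp]: "p i \<in> carrier A"
begin

definition lit :: "bool \<Rightarrow> nat \<Rightarrow> 'b" where
  "lit v i = (if v then p i else compl A (p i))"

primrec cell :: "(nat \<Rightarrow> bool) \<Rightarrow> nat \<Rightarrow> 'b" where
  "cell s 0 = \<uu>"
| "cell s (Suc n) = cell s n \<sqinter> lit (s n) n"

definition team :: "'b \<Rightarrow> team" where
  "team a = {s. \<forall>n. a \<sqinter> cell s n \<noteq> \<zz>}"

lemma lit_closed [simp]: "lit v i \<in> carrier A"
  by (simp add: lit_def)

lemma cell_closed [simp]: "cell s n \<in> carrier A"
  by (induction n) simp_all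

lemma cell_mono: "m \<le> n \<Longrightarrow> cell s n \<sqinter> cell s m = cell s n"
proof (induction n rule: dec_induct)
  case (step n)
  have "cell s (Suc n) \<sqinter> cell s m = (cell s n \<sqinter> cell s m) \<sqinter> lit (s n) n"
    by (simp add: meet_ac)
  with step.IH show ?case by simp
qed simp

lemma cell_lit: "i < n \<Longrightarrow> cell s n \<sqinter> lit (s i) i = cell s n"
proof -
  assume "i < n"
  then have *: "cell s n \<sqinter> cell s (Suc i) = cell s n" by (intro cell_mono) simp
  have "cell s n \<sqinter> cell s (Suc i) \<sqinter> lit (s i) i = cell s n \<sqinter> cell s (Suc i)"
    by (simp add: meet_assoc)
  with * show ?thesis by simp
qed

lemma cell_neq_lit: "i < n \<Longrightarrow> v \<noteq> s i \<Longrightarrow> lit v i \<sqinter> cell s n = \<zz>"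
proof -
  assume "i < n" "v \<noteq> s i"
  have "lit (s i) i \<sqinter> lit v i = \<zz>"
    using \<open>v \<noteq> s i\<close> meet_comm[of "compl A (p i)" "p i"] by (auto simp: lit_def)
  then have "cell s n \<sqinter> lit (s i) i \<sqinter> lit v i = \<zz>"
    by (simp add: meet_assoc)
  with \<open>i < n\<close> show ?thesis by (simp add: cell_lit meet_comm)
qed

lemma team_zero [simp]: "team \<zz> = {}"
  by (simp add: team_def)

text \<open>Cells shrink as the length grows, so if \<open>a\<close> and \<open>b\<close> each miss
  some cell of \<open>s\<close>, then both miss the longer of the two cells, and so does their join.
  This is where compactness of the Stone space is replaced by a maximum.\<close>

lemma team_join:
  assumes "a \<in> carrier A" "b \<in> carrier A"
  shows "team (a \<squnion> b) = team a \<union> team b"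
proof -
  have "s \<in> team a \<union> team b" if "s \<in> team (a \<squnion> b)" for s
  proof (rule ccontr)
    assume "s \<notin> team a \<union> team b"
    then obtain m n where mn: "a \<sqinter> cell s m = \<zz>" "b \<sqinter> cell s n = \<zz>"
      by (auto simp: team_def)
    define k where "k = max m n"
    have "a \<sqinter> cell s k = (a \<sqinter> cell s m) \<sqinter> cell s k"
      using assms cell_mono[of m k s] by (simp add: k_def meet_ac)
    moreover have "b \<sqinter> cell s k = (b \<sqinter> cell s n) \<sqinter> cell s k"
      using assms cell_mono[of n k s] by (simp add: k_def meet_ac)
    ultimately have "(a \<squnion> b) \<sqinter> cell s k = \<zz>"
      using assms mn by (simp add: join_meet_distrib_right)
    with that show False by (simp add: team_def)
  qed
  moreover have "team a \<union> team b \<subseteq> team (a \<squnion> b)"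
    using assms by (auto simp: team_def join_meet_distrib_right join_eq_zero_iff)
  ultimately show ?thesis by blast
qed

text \<open>A valuation is built greedily: starting from \<open>a\<close>, stage \<open>n\<close>
  takes \<open>p n\<close> if the current element meets it. Otherwise the current element already
  lies below the complement of \<open>p n\<close> and is left unchanged. Hence no stage reaches
  zero.\<close>

lemma team_nonempty:
  assumes a: "a \<in> carrier A" "a \<noteq> \<zz>"
  shows "team a \<noteq> {}"
proof -
  define c where "c = rec_nat a (\<lambda>n x. x \<sqinter> lit (x \<sqinter> p n \<noteq> \<zz>) n)"
  define s where "s n \<longleftrightarrow> c n \<sqinter> p n \<noteq> \<zz>" for n
  have c0: "c 0 = a" and cS: "c (Suc n) = c n \<sqinter> lit (s n) n" for n
    by (simp_all add: c_def s_def)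
  have ccl: "c n \<in> carrier A" for n
    by (induction n) (simp_all add: c0 cS a)
  have "c n \<noteq> \<zz>" for n
  proof (induction n)
    case (Suc n)
    show ?case
    proof (cases "s n")
      case False
      then have "c n \<sqinter> p n = \<zz>" by (simp add: s_def)
      then have "c n \<sqinter> compl A (p n) = c n"
        using meet_split[OF ccl, of "p n" n] ccl by simp
      then show ?thesis using Suc False by (simp add: cS lit_def)
    qed (simp add: cS lit_def s_def)
  qed (use a in \<open>simp add: c0\<close>)
  moreover have "c n = a \<sqinter> cell s n" for n
    by (induction n) (simp_all add: c0 cS a meet_assoc)
  ultimately show ?thesis by (auto simp: team_def)
qed

section \<open>Sets of valuations represented by elements\<close>

text \<open>In Stone terms \<open>e\<close> is the full preimage of \<open>C\<close>. Asking only
  for \<open>team e = C\<close> would be too weak: \<open>team\<close> takes images, which need not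
  commute with meets, so disjoint elements may have overlapping teams. Quantifying over all
  \<open>a\<close> ensures that \<open>e\<close> cuts teams exactly.\<close>

definition represents :: "'b \<Rightarrow> team \<Rightarrow> bool" where
  "represents e C \<longleftrightarrow> e \<in> carrier A \<and> (\<forall>a\<in>carrier A. team (a \<sqinter> e) = team a \<inter> C)"

lemma represents_closed: "represents e C \<Longrightarrow> e \<in> carrier A"
  and represents_team: "represents e C \<Longrightarrow> a \<in> carrier A \<Longrightarrow> team (a \<sqinter> e) = team a \<inter> C"
  by (simp_all add: represents_def)

lemma represents_zero: "represents \<zz> {}"
  by (simp add: represents_def)

lemma represents_one: "represents \<uu> UNIV"
  by (simp add: represents_def)

lemma represents_meet:
  "represents e C \<Longrightarrow> represents f D \<Longrightarrow> represents (e \<sqinter> f) (C \<inter> D)"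
  by (auto simp: represents_def simp flip: meet_assoc)

lemma represents_join:
  "represents e C \<Longrightarrow> represents f D \<Longrightarrow> represents (e \<squnion> f) (C \<union> D)"
  by (auto simp: represents_def meet_join_distrib team_join)

lemma represents_lit: "represents (lit v i) {s. s i = v}"
proof -
  have "team (a \<sqinter> lit v i) = team a \<inter> {s. s i = v}" if a: "a \<in> carrier A" for a
  proof (intro set_eqI iffI)
    fix s assume s: "s \<in> team (a \<sqinter> lit v i)"
    have "s i = v"
    proof (rule ccontr)
      assume "s i \<noteq> v"
      then have "a \<sqinter> lit v i \<sqinter> cell s (Suc i) = \<zz>"
        using a cell_neq_lit[of i "Suc i" v s] by (simp add: meet_assoc del: cell.simps)
      with s show False by (simp add: team_def del: cell.simps)
    qed
    \<comment> \<open>Monotonicity of \<open>team\<close>, obtained by splitting \<open>a\<close>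
      along the literal and using \<open>team_join\<close>.\<close>
    moreover have "s \<in> team (a \<sqinter> lit v i \<squnion> a \<sqinter> compl A (lit v i))"
      using s a by (simp add: team_join)
    ultimately show "s \<in> team a \<inter> {s. s i = v}" using a by (simp add: meet_split)
  next
    fix s assume s: "s \<in> team a \<inter> {s. s i = v}"
    have "a \<sqinter> lit v i \<sqinter> cell s n \<noteq> \<zz>" for n
    proof
      assume *: "a \<sqinter> lit v i \<sqinter> cell s n = \<zz>"
      \<comment> \<open>Besides reaching \<open>n\<close>, the length must exceed \<open>i\<close>,
        so that the cell lies below the literal.\<close>
      define k where "k = max n (Suc i)"
      have k: "cell s k \<sqinter> cell s n = cell s k" "cell s k \<sqinter> lit v i = cell s k"
        using cell_mono[of n k s] cell_lit[of i k s] s by (auto simp: k_def)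
      have "a \<sqinter> cell s k = a \<sqinter> (cell s k \<sqinter> lit v i \<sqinter> cell s n)"
        by (simp add: k)
      also have "\<dots> = (a \<sqinter> lit v i \<sqinter> cell s n) \<sqinter> cell s k"
        using a by (simp add: meet_ac)
      finally have "a \<sqinter> cell s k = \<zz>" by (simp add: *)
      with s show False by (auto simp: team_def)
    qed
    then show "s \<in> team (a \<sqinter> lit v i)" by (simp add: team_def)
  qed
  then show ?thesis by (simp add: represents_def)
qed

text \<open>The team of \<open>a\<close> is the union of the teams of its parts inside and outside
  \<open>e\<close>. The outside part has zero meet with \<open>e\<close>, so its team avoids
  \<open>C\<close>.\<close>

lemma represents_compl:
  assumes "represents e C"
  shows "represents (compl A e) (- C)"
proof -
  note e = represents_closed[OF assms]
  have "team (a \<sqinter> compl A e) = team a \<inter> - C" if a: "a \<in> carrier A" for a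
  proof -
    have "team a = team (a \<sqinter> e) \<union> team (a \<sqinter> compl A e)"
      using a e by (simp add: meet_split flip: team_join)
    moreover have "team (a \<sqinter> compl A e) \<inter> C = team (a \<sqinter> compl A e \<sqinter> e)"
      using a e represents_team[OF assms] by simp
    moreover have "a \<sqinter> compl A e \<sqinter> e = \<zz>"
      using a e meet_comm[of "compl A e" e] by (simp add: meet_assoc)
    ultimately show ?thesis using represents_team[OF assms a] by auto
  qed
  with e show ?thesis by (simp add: represents_def)
qed

text \<open>Although \<open>team\<close> need not be injective, \<open>team_nonempty\<close> lets it
  detect zero. Applied to the part of \<open>a\<close> outside \<open>e\<close>, this reflects
  inclusion whenever the right-hand side is represented.\<close>

lemma le_iff_team_subset:
  assumes "represents e C" "a \<in> carrier A"
  shows "a \<sqinter> e = a \<longleftrightarrow> team a \<subseteq> C"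
proof
  assume "a \<sqinter> e = a"
  then show "team a \<subseteq> C" using represents_team[OF assms] by auto
next
  note e = represents_closed[OF assms(1)]
  assume "team a \<subseteq> C"
  then have "team (a \<sqinter> compl A e) = {}"
    using represents_team[OF represents_compl[OF assms(1)] assms(2)] by auto
  then have "a \<sqinter> compl A e = \<zz>"
    using team_nonempty[of "a \<sqinter> compl A e"] assms(2) e by auto
  then show "a \<sqinter> e = a" using assms(2) e by (simp add: le_if_meet_compl)
qed

text \<open>However large \<open>Y\<close> is, only finitely many patterns of length
  \<open>n\<close> occur. Branching on the last coordinate builds the element recursively from
  literals, with a different \<open>Y\<close> in each branch.\<close>

lemma cylinder_represented: "\<exists>e. represents e (cylinder n Y)"
proof (induction n arbitrary: Y)
  case 0
  have "cylinder 0 Y = (if Y = {} then {} else UNIV)" by (auto simp: cylinder_def)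
  then show ?case using represents_zero represents_one by auto
next
  case (Suc n)
  obtain e where e: "\<And>v. represents (e v) (cylinder n {t\<in>Y. t n = v})"
    using choice[of "\<lambda>v e. represents e (cylinder n {t\<in>Y. t n = v})"] Suc by blast
  have "represents (e False \<sqinter> lit False n \<squnion> e True \<sqinter> lit True n) (cylinder (Suc n) Y)"
    unfolding cylinder_Suc UNIV_bool UN_insert UN_empty Un_empty_right
    by (intro represents_join represents_meet represents_lit e)
  then show ?case by blast
qed

end

section \<open>Locality of team semantics\<close>

primrec var_bound :: "pt_fm \<Rightarrow> nat" where
  "var_bound (PVar i) = Suc i"
| "var_bound (PNegVar i) = Suc i"
| "var_bound PIBot = 0"
| "var_bound PNB = 0"
| "var_bound (PIOr \<phi> \<psi>) = max (var_bound \<phi>) (var_bound \<psi>)"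
| "var_bound (PAnd \<phi> \<psi>) = max (var_bound \<phi>) (var_bound \<psi>)"
| "var_bound (POr \<phi> \<psi>) = max (var_bound \<phi>) (var_bound \<psi>)"

definition agree :: "nat \<Rightarrow> (nat \<Rightarrow> bool) \<Rightarrow> (nat \<Rightarrow> bool) \<Rightarrow> bool" where
  "agree n s t \<longleftrightarrow> (\<forall>i<n. s i = t i)"

text \<open>The relation says that both teams have the same restrictions to the coordinates below
  \<open>n\<close>. It is formulated with \<open>rel_set\<close> because a split of one team then
  transfers to the other: each half is matched by the members that agree below \<open>n\<close> with
  an element of that half.\<close>

lemma pt_sem_local:
  assumes "var_bound \<psi> \<le> n" "rel_set (agree n) X X'" "X \<in> pt_sem \<psi>"
  shows "X' \<in> pt_sem \<psi>"
  using assms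
proof (induction \<psi> arbitrary: X X')
  case (PIOr \<psi> \<chi>)
  then obtain Y Z where YZ: "X = Y \<union> Z" "Y \<in> pt_sem \<psi>" "Z \<in> pt_sem \<chi>" by auto
  define cut where "cut W = {s\<in>X'. \<exists>t\<in>W. agree n t s}" for W
  have cut: "rel_set (agree n) W (cut W)" if "W \<subseteq> X" for W
    using PIOr.prems(2) that unfolding rel_set_def cut_def by blast
  have "cut Y \<in> pt_sem \<psi>" "cut Z \<in> pt_sem \<chi>"
    using PIOr.IH(1)[OF _ cut YZ(2)] PIOr.IH(2)[OF _ cut YZ(3)] PIOr.prems(1) YZ(1) by auto
  moreover have "X' = cut Y \<union> cut Z"
    using PIOr.prems(2) YZ(1) unfolding rel_set_def cut_def by blast
  ultimately show ?case by auto
next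
  case (PVar i)
  then show ?case by (fastforce simp: rel_set_def agree_def)
next
  case (PNegVar i)
  then show ?case by (fastforce simp: rel_set_def agree_def)
qed (auto simp: rel_set_def)

section \<open>Box and strict negation under a homomorphism\<close>

lemma ltp_homD:
  assumes "ltp_hom A H"
  shows "H \<phi> \<subseteq> carrier A" "H Bot = {}" "H (Neg \<phi>) = carrier A - H \<phi>"
    "H (Or \<phi> \<psi>) = H \<phi> \<union> H \<psi>" "H (And \<phi> \<psi>) = H \<phi> \<inter> H \<psi>" "H IBot = {zero A}"
    "H (IOr \<phi> \<psi>) = {join A a b |a b. a \<in> H \<phi> \<and> b \<in> H \<psi>}"
    "H (IAnd \<phi> \<psi>) = {meet A a b |a b. a \<in> H \<phi> \<and> b \<in> H \<psi>}"
    "H Top = carrier A" "H NB = carrier A - {zero A}"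
  using assms by (simp_all add: ltp_hom_def Top_def NB_def)

context boolean_alg
begin

text \<open>\<open>Down\<close> and \<open>Up\<close> form downward and upward closures. As soon as
  one element falsifies the formula, the downward closure of its negation contains zero, whose
  upward closure is the whole carrier. Box is therefore a global modality.\<close>

lemma hom_Box:
  assumes "ltp_hom A H"
  shows "H (Box \<phi>) = (if H \<phi> = carrier A then carrier A else {})"
proof -
  have "a \<in> H (Up (Down (Neg \<phi>)))" if "b \<in> carrier A - H \<phi>" "a \<in> carrier A" for a b
  proof -
    have "\<zz> = b \<sqinter> \<zz>" using that by simp
    then have "\<zz> \<in> H (Down (Neg \<phi>))"
      using that zero_closed unfolding Down_def ltp_homD(3,8,9)[OF assms] by blast
    moreover have "a = \<zz> \<squnion> a" using that by simp
    ultimately show ?thesis using that unfolding Up_def ltp_homD(7,9)[OF assms] by blast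
  qed
  moreover have "H (Up (Down (Neg \<phi>))) = {}" if "H \<phi> = carrier A"
    using that by (simp add: Up_def Down_def ltp_homD[OF assms])
  ultimately show ?thesis
    using ltp_homD(1)[OF assms, of \<phi>] unfolding Box_def ltp_homD(3)[OF assms] by auto
qed

text \<open>The formula inside \<open>Up\<close> describes the nonzero elements below some member of
  \<open>H \<phi>\<close>. Lying above one of these is the same as having a nonzero meet with a
  member.\<close>

lemma hom_SNeg:
  assumes hom: "ltp_hom A H"
  shows "H (SNeg \<phi>) = {a \<in> carrier A. \<forall>b\<in>H \<phi>. a \<sqinter> b = \<zz>}"
proof (intro set_eqI iffI CollectI conjI ballI)
  note S = SNeg_def Up_def Down_def ltp_homD[OF hom]
  have sub: "b \<in> carrier A" if "b \<in> H \<chi>" for b \<chi> using ltp_homD(1)[OF hom] that by blast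
  fix a assume a: "a \<in> H (SNeg \<phi>)"
  show "a \<in> carrier A" using a sub by blast
  fix b assume b: "b \<in> H \<phi>"
  note cl = \<open>a \<in> carrier A\<close> sub[OF b]
  show "a \<sqinter> b = \<zz>"
  proof (rule ccontr)
    assume "a \<sqinter> b \<noteq> \<zz>"
    then have "b \<sqinter> a \<in> H (And (Down \<phi>) NB)"
      using b cl meet_comm[of a b] unfolding S by auto
    \<comment> \<open>Absorption puts \<open>a\<close> in the upward closure of the nonzero element
      \<open>meet A b a\<close>.\<close>
    moreover have "a = b \<sqinter> a \<squnion> a"
      using cl join_absorb[of a b] by (simp add: join_comm[of _ a] meet_comm[of b a])
    ultimately have "a \<in> H (Up (And (Down \<phi>) NB))"
      using cl(1) unfolding Up_def ltp_homD(7,9)[OF hom] by blast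
    then show False using a by (simp add: SNeg_def ltp_homD(3)[OF hom])
  qed
next
  note S = SNeg_def Up_def Down_def ltp_homD[OF hom]
  fix a assume a: "a \<in> {a \<in> carrier A. \<forall>b\<in>H \<phi>. a \<sqinter> b = \<zz>}"
  show "a \<in> H (SNeg \<phi>)"
  proof (rule ccontr)
    assume "a \<notin> H (SNeg \<phi>)"
    then obtain b c t where b: "b \<in> H \<phi>" and ct: "c \<in> carrier A" "t \<in> carrier A"
        and nz: "b \<sqinter> c \<noteq> \<zz>" and eq: "a = b \<sqinter> c \<squnion> t"
      using a unfolding S by auto
    have bcl: "b \<in> carrier A" using ltp_homD(1)[OF hom] b by blast
    have "b \<sqinter> c = b \<sqinter> c \<sqinter> a"
      using bcl ct by (simp add: eq meet_absorb)
    also have "\<dots> = (a \<sqinter> b) \<sqinter> c"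
      using a bcl ct by (simp add: meet_ac)
    also have "\<dots> = \<zz>" using a b ct by simp
    finally show False using nz by simp
  qed
qed

text \<open>The generator \<open>p\<close> is the part in \<open>H \<phi>\<close> of a split of one.
  The other part is disjoint from every member of \<open>H \<phi>\<close>, which forces all members
  below \<open>p\<close>.\<close>

lemma principal_if_total:
  assumes hom: "ltp_hom A H" and total: "H (IOr \<phi> (SNeg \<phi>)) = carrier A"
  obtains p where "p \<in> carrier A" "H \<phi> = {a \<in> carrier A. a \<sqinter> p = a}"
    "H (SNeg \<phi>) = {a \<in> carrier A. a \<sqinter> p = \<zz>}"
proof -
  have split: "\<exists>u v. a = u \<squnion> v \<and> u \<in> H \<phi> \<and> v \<in> carrier A \<and> (\<forall>b\<in>H \<phi>. v \<sqinter> b = \<zz>)"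
    if "a \<in> carrier A" for a
    using that total unfolding ltp_homD(7)[OF hom] hom_SNeg[OF hom] by blast
  have sub: "b \<in> carrier A" if "b \<in> H \<phi>" for b using ltp_homD(1)[OF hom] that by blast
  obtain p q where pq: "\<uu> = p \<squnion> q" "p \<in> H \<phi>" "q \<in> carrier A" "\<And>b. b \<in> H \<phi> \<Longrightarrow> q \<sqinter> b = \<zz>"
    using split[OF one_closed] by blast
  note p = sub[OF pq(2)]
  have le: "u \<sqinter> p = u" if "u \<in> H \<phi>" for u
  proof -
    have "u = u \<sqinter> (p \<squnion> q)" using sub[OF that] by (simp flip: pq(1))
    also have "\<dots> = u \<sqinter> p \<squnion> u \<sqinter> q" using sub[OF that] p pq(3) by (simp add: meet_join_distrib)
    also have "u \<sqinter> q = \<zz>" using pq(4)[OF that] sub[OF that] pq(3) by (simp add: meet_comm)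
    finally show ?thesis using sub[OF that] p by simp
  qed
  have down: "a \<sqinter> p \<in> H \<phi>" if a: "a \<in> carrier A" for a
  proof -
    \<comment> \<open>Downward closure is not assumed; it comes from totality. In a split of
      \<open>a\<close>, the part \<open>v\<close> is disjoint from \<open>p\<close> while
      \<open>u\<close> lies below \<open>p\<close>, so the meet of \<open>a\<close> with
      \<open>p\<close> is exactly \<open>u\<close>, a member of \<open>H \<phi>\<close>.\<close>
    obtain u v where uv: "a = u \<squnion> v" "u \<in> H \<phi>" "v \<in> carrier A" "v \<sqinter> p = \<zz>"
      using split[OF a] pq(2) by blast
    then have "a \<sqinter> p = u" using p sub le by (simp add: join_meet_distrib_right)
    with uv show ?thesis by simp
  qed
  have eq: "H \<phi> = {a \<in> carrier A. a \<sqinter> p = a}"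
    using le sub down by (auto, metis)
  have "a \<sqinter> b = \<zz>" if "a \<in> carrier A" "a \<sqinter> p = \<zz>" "b \<in> H \<phi>" for a b
  proof -
    have "a \<sqinter> b = a \<sqinter> (b \<sqinter> p)" using le[OF that(3)] by simp
    also have "\<dots> = (a \<sqinter> p) \<sqinter> b" using that(1) sub[OF that(3)] p by (simp add: meet_ac)
    finally show ?thesis using that(2) sub[OF that(3)] by simp
  qed
  then have "H (SNeg \<phi>) = {a \<in> carrier A. a \<sqinter> p = \<zz>}"
    using pq(2) unfolding hom_SNeg[OF hom] by auto
  with p eq show thesis by (rule that)
qed

end

section \<open>Truth of formulas at an element and at its team\<close>

context valued_boolean_alg
begin

lemma hom_iff_team:
  assumes hom: "ltp_hom A H"
    and pos: "\<And>i. H (Var i) = {a \<in> carrier A. a \<sqinter> p i = a}"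
    and neg: "\<And>i. H (SNeg (Var i)) = {a \<in> carrier A. a \<sqinter> p i = \<zz>}"
    and a: "a \<in> carrier A"
  shows "a \<in> H (fm_of \<psi>) \<longleftrightarrow> team a \<in> pt_sem \<psi>"
  using a
proof (induction \<psi> arbitrary: a)
  case (PVar i)
  then show ?case
    using le_iff_team_subset[OF represents_lit[of True i]] by (auto simp: pos lit_def)
next
  case (PNegVar i)
  \<comment> \<open>Since \<open>team\<close> detects zero, disjointness from \<open>p i\<close> can
    be read off from the valuations in \<open>team a\<close> that make \<open>i\<close>
    true.\<close>
  have "a \<sqinter> p i = \<zz> \<longleftrightarrow> team (a \<sqinter> p i) = {}"
    using team_nonempty[of "a \<sqinter> p i"] PNegVar by auto
  then show ?case
    using PNegVar represents_team[OF represents_lit[of True i]] by (auto simp: neg lit_def)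
next
  case PIBot
  then show ?case using team_nonempty[of a] by (auto simp: ltp_homD[OF hom])
next
  case PNB
  then show ?case using team_nonempty[of a] by (auto simp: ltp_homD[OF hom])
next
  case (PIOr \<psi> \<chi>)
  have sub: "b \<in> carrier A" if "b \<in> H \<xi>" for b \<xi> using ltp_homD(1)[OF hom] that by blast
  show ?case
  proof
    assume "a \<in> H (fm_of (PIOr \<psi> \<chi>))"
    then obtain b c where "a = b \<squnion> c" "b \<in> H (fm_of \<psi>)" "c \<in> H (fm_of \<chi>)"
      by (auto simp: ltp_homD[OF hom])
    moreover from this have "team b \<in> pt_sem \<psi>" "team c \<in> pt_sem \<chi>"
      using PIOr.IH sub by blast+
    ultimately show "team a \<in> pt_sem (PIOr \<psi> \<chi>)" using sub by (auto simp: team_join)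
  next
    assume "team a \<in> pt_sem (PIOr \<psi> \<chi>)"
    then obtain Y Z where YZ: "team a = Y \<union> Z" "Y \<in> pt_sem \<psi>" "Z \<in> pt_sem \<chi>" by auto
    define n where "n = max (var_bound \<psi>) (var_bound \<chi>)"
    obtain e f where e: "represents e (cylinder n Y)" and f: "represents f (cylinder n Z)"
      using cylinder_represented by metis
    \<comment> \<open>Enlarging \<open>W\<close> to its cylinder inside \<open>team a\<close> adds
      only valuations that agree below \<open>n\<close> with a member of \<open>W\<close>, so
      formulas with variables below \<open>n\<close> remain satisfied.\<close>
    have cyl: "rel_set (agree n) W (team a \<inter> cylinder n W)" if "W \<subseteq> team a" for W
      using that by (auto simp: rel_set_def agree_def cylinder_def)
    have "team (a \<sqinter> e) \<in> pt_sem \<psi>"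
      unfolding represents_team[OF e PIOr.prems]
      using YZ by (intro pt_sem_local[OF _ cyl YZ(2)]) (auto simp: n_def)
    then have b: "a \<sqinter> e \<in> H (fm_of \<psi>)"
      using PIOr represents_closed[OF e] by simp
    have "team (a \<sqinter> f) \<in> pt_sem \<chi>"
      unfolding represents_team[OF f PIOr.prems]
      using YZ by (intro pt_sem_local[OF _ cyl YZ(3)]) (auto simp: n_def)
    then have c: "a \<sqinter> f \<in> H (fm_of \<chi>)"
      using PIOr represents_closed[OF f] by simp
    \<comment> \<open>The cylinders may overlap: internal disjunction asks for a cover of
      \<open>a\<close>, not for disjoint parts.\<close>
    have "team a \<subseteq> cylinder n Y \<union> cylinder n Z"
      unfolding YZ(1) by (auto simp: cylinder_def)
    then have "a \<sqinter> (e \<squnion> f) = a"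
      using le_iff_team_subset[OF represents_join[OF e f]] PIOr.prems by blast
    then have "a = a \<sqinter> e \<squnion> a \<sqinter> f"
      using PIOr.prems represents_closed[OF e] represents_closed[OF f]
      by (simp add: meet_join_distrib)
    with b c show "a \<in> H (fm_of (PIOr \<psi> \<chi>))"
      unfolding fm_of.simps ltp_homD(7)[OF hom] by blast
  qed
qed (auto simp: ltp_homD[OF hom])

end

section \<open>From team entailment to entailment over all Boolean algebras\<close>

lemma pt_entails_imp_ltp_entails:
  assumes "pt_entails \<Delta> \<phi>"
  shows "ltp_entails TYPE('u) (PVA \<union> fm_of ` \<Delta>) (fm_of \<phi>)"
  unfolding ltp_entails_def
proof (intro allI impI subsetI)
  fix A :: "'u balg" and H a
  assume BA: "boolean_alg A" and hom: "ltp_hom A H"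
    and a: "a \<in> carrier A \<inter> (\<Inter>\<delta>\<in>PVA \<union> fm_of ` \<Delta>. H \<delta>)"
  interpret boolean_alg A by (rule BA)
  \<comment> \<open>A single element in the value of a box makes that value nonempty, so the boxed
    formula holds throughout the carrier. This yields a generator for each variable, not just a
    condition on \<open>a\<close>.\<close>
  have "a \<in> H (Box (IOr (Var i) (SNeg (Var i))))" for i
    using a unfolding PVA_def by blast
  then have "H (IOr (Var i) (SNeg (Var i))) = carrier A" for i
    unfolding hom_Box[OF hom] by (metis empty_iff)
  then have "\<exists>p. p \<in> carrier A \<and> H (Var i) = {a \<in> carrier A. meet A a p = a} \<and>
      H (SNeg (Var i)) = {a \<in> carrier A. meet A a p = zero A}" for i
    by (rule principal_if_total[OF hom, of "Var i"]) blast
  then obtain p where "\<forall>i. p i \<in> carrier A \<and> H (Var i) = {a \<in> carrier A. meet A a (p i) = a} \<and>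
      H (SNeg (Var i)) = {a \<in> carrier A. meet A a (p i) = zero A}"
    using choice[of "\<lambda>i p. p \<in> carrier A \<and> H (Var i) = {a \<in> carrier A. meet A a p = a} \<and>
      H (SNeg (Var i)) = {a \<in> carrier A. meet A a p = zero A}"] by blast
  then have p: "\<And>i. p i \<in> carrier A"
      "\<And>i. H (Var i) = {a \<in> carrier A. meet A a (p i) = a}"
      "\<And>i. H (SNeg (Var i)) = {a \<in> carrier A. meet A a (p i) = zero A}"
    by blast+
  interpret valued_boolean_alg A p by unfold_locales (rule p(1))
  have iff: "a \<in> H (fm_of \<psi>) \<longleftrightarrow> team a \<in> pt_sem \<psi>" for \<psi>
    using hom_iff_team[OF hom p(2,3)] a by blast
  then have "team a \<in> (\<Inter>\<delta>\<in>\<Delta>. pt_sem \<delta>)" using a by blast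
  then show "a \<in> H (fm_of \<phi>)" using assms iff unfolding pt_entails_def by blast
qed

section \<open>Team semantics as an interpretation of LTP\<close>

definition team_alg :: "team balg" where
  "team_alg = \<lparr> carrier = UNIV, zero = {}, one = UNIV, compl = uminus, join = (\<union>), meet = (\<inter>) \<rparr>"

lemma team_alg_simps [simp]:
  "carrier team_alg = UNIV" "zero team_alg = {}" "one team_alg = UNIV"
  "compl team_alg X = - X" "join team_alg X Y = X \<union> Y" "meet team_alg X Y = X \<inter> Y"
  by (simp_all add: team_alg_def)

lemma boolean_alg_team_alg: "boolean_alg team_alg"
  by unfold_locales auto

text \<open>The extension of \<open>pt_sem\<close> from team logic to all of \<open>fm\<close>,
  because \<open>ltp_hom\<close> constrains every formula.\<close>

primrec team_sem :: "fm \<Rightarrow> team set" where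
  "team_sem (Var i) = {X. \<forall>s\<in>X. s i}"
| "team_sem Bot = {}"
| "team_sem IBot = {{}}"
| "team_sem (Neg \<phi>) = - team_sem \<phi>"
| "team_sem (INeg \<phi>) = {- X |X. X \<in> team_sem \<phi>}"
| "team_sem (Or \<phi> \<psi>) = team_sem \<phi> \<union> team_sem \<psi>"
| "team_sem (And \<phi> \<psi>) = team_sem \<phi> \<inter> team_sem \<psi>"
| "team_sem (IOr \<phi> \<psi>) = {X \<union> Y |X Y. X \<in> team_sem \<phi> \<and> Y \<in> team_sem \<psi>}"
| "team_sem (IAnd \<phi> \<psi>) = {X \<inter> Y |X Y. X \<in> team_sem \<phi> \<and> Y \<in> team_sem \<psi>}"

lemma ltp_hom_team_sem: "ltp_hom team_alg team_sem"
  by (simp add: ltp_hom_def Compl_eq_Diff_UNIV)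

lemma team_sem_SNeg_Var: "team_sem (SNeg (Var i)) = {X. \<forall>s\<in>X. \<not> s i}"
proof -
  \<comment> \<open>Singletons serve as test teams: \<open>{s}\<close> satisfies the variable
    exactly when \<open>s i\<close> holds.\<close>
  have "\<not> s i" if "\<forall>Y. (\<forall>s\<in>Y. s i) \<longrightarrow> X \<inter> Y = {}" "s \<in> X" for X s
    using that(1)[rule_format, of "{s}"] that(2) by auto
  then show ?thesis
    using boolean_alg.hom_SNeg[OF boolean_alg_team_alg ltp_hom_team_sem, of "Var i"] by auto
qed

lemma team_sem_fm_of: "team_sem (fm_of \<psi>) = pt_sem \<psi>"
  by (induction \<psi>) (auto simp: team_sem_SNeg_Var NB_def)

text \<open>Every team splits into the valuations making the variable true and those making it
  false, so the formula under the box has the value \<open>UNIV\<close>.\<close>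

lemma team_sem_PVA:
  assumes "\<psi> \<in> PVA"
  shows "team_sem \<psi> = UNIV"
proof -
  obtain i where i: "\<psi> = Box (IOr (Var i) (SNeg (Var i)))" using assms by (auto simp: PVA_def)
  have "X \<in> team_sem (IOr (Var i) (SNeg (Var i)))" for X
  proof -
    have "X = {s\<in>X. s i} \<union> {s\<in>X. \<not> s i}" by blast
    then show ?thesis by (simp add: team_sem_SNeg_Var) blast
  qed
  then show ?thesis
    unfolding i using boolean_alg.hom_Box[OF boolean_alg_team_alg ltp_hom_team_sem] by auto
qed

theorem theorem6p7:
  fixes \<Delta> :: "pt_fm set" and \<phi> :: pt_fm
  assumes "infinite (UNIV :: 'u set)"
  shows "pt_entails \<Delta> \<phi> \<longleftrightarrow> ltp_entails TYPE('u) (PVA \<union> fm_of ` \<Delta>) (fm_of \<phi>)"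
proof
  assume "ltp_entails TYPE('u) (PVA \<union> fm_of ` \<Delta>) (fm_of \<phi>)"
  \<comment> \<open>The model \<open>team_alg\<close> lives on the type \<open>team\<close>, whose
    cardinality may exceed that of \<open>'u\<close>, so the assumed entailment is first moved to
    that type.\<close>
  then have "ltp_entails TYPE(team) (PVA \<union> fm_of ` \<Delta>) (fm_of \<phi>)"
    by (rule ltp_entails_universe[OF assms])
  then have "carrier team_alg \<inter> (\<Inter>\<delta>\<in>PVA \<union> fm_of ` \<Delta>. team_sem \<delta>) \<subseteq> team_sem (fm_of \<phi>)"
    using boolean_alg_team_alg ltp_hom_team_sem unfolding ltp_entails_def by blast
  then show "pt_entails \<Delta> \<phi>"
    by (auto simp: pt_entails_def team_sem_fm_of team_sem_PVA)
qed (rule pt_entails_imp_ltp_entails)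

end
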